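(* Fix $\mathbf{w}_0\in\Omega$, $\alpha>1$, and $\epsilon_0>0$ with $f(\mathbf{w}_0)-f_*\le\epsilon_0$. The iteration complexity of RSG for obtaining a $2\epsilon$-optimal solution is $O\left(\frac{\alpha^2G^2B_\epsilon^2}{\epsilon^2}\lceil\log_\alpha(\frac{\epsilon_0}{\epsilon})\rceil\right)$. Precisely: there is a constant $C>0$ independent of $\epsilon$ such that for every $\epsilon\in(0,\epsilon_0]$ with $\mathcal{L}_\epsilon\ne\emptyset$, running RSG$(\mathbf{w}_0,K,t,\alpha)$ with $t=\left\lceil\frac{\alpha^2G^2B_\epsilon^2}{\epsilon^2}\right\rceil$ and $K=\lceil\log_\alpha(\epsilon_0/\epsilon)\rceil$ returns $\mathbf{w}_K$ with $f(\mathbf{w}_K)-f_*\le2\epsilon$ after a total number of iterations at most $C\,\frac{\alpha^2G^2B_\epsilon^2}{\epsilon^2}\lceil\log_\alpha(\frac{\epsilon_0}{\epsilon})\rceil$.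
   Context: Problem: $f:\mathbb{R}^d\to(-\infty,+\infty]$ is lower semicontinuous and convex, $\Omega\subseteq\mathrm{dom}(f)$ is a closed convex subset of $\mathbb{R}^d$, $f_*:=\min_{\mathbf{w}\in\Omega}f(\mathbf{w})$ is attained, and $\Omega_*\subseteq\Omega$ is the (nonempty) set of minimizers of $f$ over $\Omega$. No smoothness or strong convexity is assumed. Bounded subgradients: there is a constant $G>0$ such that for every $\mathbf{w}\in\Omega$ the subdifferential $\partial f(\mathbf{w})$ is nonempty and $\|\mathbf{v}\|_2\le G$ for all $\mathbf{v}\in\partial f(\mathbf{w})$. Level sets: $\mathcal{L}_\epsilon:=\{\mathbf{w}\in\Omega: f(\mathbf{w})=f_*+\epsilon\}$. $B_\epsilon:=\sup_{\mathbf{w}\in\mathcal{L}_\epsilon}\min_{\mathbf{u}\in\Omega_*}\|\mathbf{w}-\mathbf{u}\|_2$, which is assumed finite. Algorithm RSG$(\mathbf{w}_0,K,t,\alpha)$ (given $\epsilon_0$ and $G$): for $k=1,\dots,K$ let $\eta_k=\epsilon_0/(\alpha^kG^2)$; set $\mathbf{x}_1=\mathbf{w}_{k-1}$ and, for $\tau=1,\dots,t$, $\mathbf{x}_{\tau+1}=\Pi_\Omega[\mathbf{x}_\tau-\eta_k\mathbf{g}_\tau]$, where $\mathbf{g}_\tau\in\partial f(\mathbf{x}_\tau)$ is an arbitrary subgradient returned by an oracle and $\Pi_\Omega$ is the Euclidean projection onto $\Omega$; set $\mathbf{w}_k=\frac1t\sum_{\tau=1}^t\mathbf{x}_\tau$.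 Output $\mathbf{w}_K$. Each $k$ is a stage; each $\tau$ within a stage is one iteration, so the total number of iterations is $tK$. *)

theory Defs
  imports "HOL-Analysis.Analysis"
begin

text \<open>Extended-real-valued functions, with values in \<open>(-\<infinity>, \<infinity>]\<close>; the value \<open>-\<infinity>\<close> is
  excluded by an explicit hypothesis wherever these notions are used.\<close>

definition eff_dom :: "('a \<Rightarrow> ereal) \<Rightarrow> 'a set" where
  "eff_dom f = {w. f w < \<infinity>}"

definition lower_semicont :: "('a::topological_space \<Rightarrow> ereal) \<Rightarrow> bool" where
  "lower_semicont f \<longleftrightarrow> (\<forall>x. f x \<le> Liminf (at x) f)"

text \<open>The library's \<open>convex_on\<close> only covers real-valued functions.  At the endpoints
  \<open>s = 0, 1\<close> the convention \<open>0 * \<infinity> = 0\<close> makes the inequality trivial.\<close>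

definition ext_convex :: "('a::real_vector \<Rightarrow> ereal) \<Rightarrow> bool" where
  "ext_convex f \<longleftrightarrow> (\<forall>x y. \<forall>s\<in>{0..1::real}.
     f ((1 - s) *\<^sub>R x + s *\<^sub>R y) \<le> ereal (1 - s) * f x + ereal s * f y)"

definition subdifferential :: "('a::real_inner \<Rightarrow> ereal) \<Rightarrow> 'a \<Rightarrow> 'a set" where
  "subdifferential f w = {v. \<forall>u. f u \<ge> f w + ereal (v \<bullet> (u - w))}"

definition min_value :: "('a \<Rightarrow> ereal) \<Rightarrow> 'a set \<Rightarrow> ereal" where
  "min_value f \<Omega> = (INF w\<in>\<Omega>. f w)"

definition minimizers :: "('a \<Rightarrow> ereal) \<Rightarrow> 'a set \<Rightarrow> 'a set" where
  "minimizers f \<Omega> = {w \<in> \<Omega>. \<forall>u\<in>\<Omega>. f w \<le> f u}"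

definition level_set :: "('a \<Rightarrow> ereal) \<Rightarrow> 'a set \<Rightarrow> real \<Rightarrow> 'a set" where
  "level_set f \<Omega> \<epsilon> = {w \<in> \<Omega>. f w = min_value f \<Omega> + ereal \<epsilon>}"

text \<open>\<open>level_dists f \<Omega> \<epsilon>\<close> collects the distances from the points of the level set to the
  set of minimizers; \<open>infdist\<close> is an attained minimum when that set is closed and
  nonempty.  The supremum is a real \<open>Sup\<close>, meaningful when the set is nonempty and
  bounded above, i.e. when the level set is nonempty and the supremum is finite.\<close>

definition level_dists :: "('a::metric_space \<Rightarrow> ereal) \<Rightarrow> 'a set \<Rightarrow> real \<Rightarrow> real set" where
  "level_dists f \<Omega> \<epsilon> = (\<lambda>w. infdist w (minimizers f \<Omega>)) ` level_set f \<Omega> \<epsilon>"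

definition level_radius :: "('a::metric_space \<Rightarrow> ereal) \<Rightarrow> 'a set \<Rightarrow> real \<Rightarrow> real" where
  "level_radius f \<Omega> \<epsilon> = Sup (level_dists f \<Omega> \<epsilon>)"

text \<open>The oracle may return a different subgradient at the same point in each stage
  \<open>k\<close> and iteration \<open>\<tau>\<close>.  Since the initial point is fixed, every sequence of
  subgradients chosen adaptively along a run is realised by some oracle of this type.\<close>

definition subgradient_oracle ::
  "('a::real_inner \<Rightarrow> ereal) \<Rightarrow> 'a set \<Rightarrow> (nat \<Rightarrow> nat \<Rightarrow> 'a \<Rightarrow> 'a) \<Rightarrow> bool" where
  "subgradient_oracle f \<Omega> orc \<longleftrightarrow> (\<forall>k \<tau>. \<forall>x\<in>\<Omega>. orc k \<tau> x \<in> subdifferential f x)"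

text \<open>\<open>sg_iterate \<Omega> \<eta> g x1 n\<close> is the iterate \<open>x\<^sub>\<tau>\<close> with \<open>\<tau> = n + 1\<close>; the argument \<open>g \<tau>\<close>
  is the oracle at iteration \<open>\<tau>\<close>.\<close>

primrec sg_iterate ::
  "(real^'d) set \<Rightarrow> real \<Rightarrow> (nat \<Rightarrow> real^'d \<Rightarrow> real^'d) \<Rightarrow> real^'d \<Rightarrow> nat \<Rightarrow> real^'d" where
  "sg_iterate \<Omega> \<eta> g x1 0 = x1"
| "sg_iterate \<Omega> \<eta> g x1 (Suc n) =
     closest_point \<Omega> (sg_iterate \<Omega> \<eta> g x1 n - \<eta> *\<^sub>R g (Suc n) (sg_iterate \<Omega> \<eta> g x1 n))"

definition sg_average ::
  "(real^'d) set \<Rightarrow> real \<Rightarrow> (nat \<Rightarrow> real^'d \<Rightarrow> real^'d) \<Rightarrow> real^'d \<Rightarrow> nat \<Rightarrow> real^'d" where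
  "sg_average \<Omega> \<eta> g x1 t = (1 / real t) *\<^sub>R (\<Sum>\<tau>=1..t. sg_iterate \<Omega> \<eta> g x1 (\<tau> - 1))"

primrec RSG ::
  "(real^'d) set \<Rightarrow> real \<Rightarrow> real \<Rightarrow> (nat \<Rightarrow> nat \<Rightarrow> real^'d \<Rightarrow> real^'d) \<Rightarrow>
   real^'d \<Rightarrow> nat \<Rightarrow> nat \<Rightarrow> real \<Rightarrow> real^'d" where
  "RSG \<Omega> G \<epsilon>0 orc w0 0 t \<alpha> = w0"
| "RSG \<Omega> G \<epsilon>0 orc w0 (Suc k) t \<alpha> =
     sg_average \<Omega> (\<epsilon>0 / (\<alpha> ^ Suc k * G\<^sup>2)) (orc (Suc k)) (RSG \<Omega> G \<epsilon>0 orc w0 k t \<alpha>) t"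

end

theory Submission
  imports Defs
begin

text \<open>Write \<open>F\<close> for the finite real function that \<open>f\<close> induces on \<open>\<Omega>\<close>, \<open>m\<close> for its minimum over
  \<open>\<Omega>\<close>, and \<open>\<epsilon>\<^sub>k = \<epsilon>0 / \<alpha> ^ k\<close>.  The theorem rests on the invariant \<open>F w\<^sub>k \<le> m + \<epsilon> + \<epsilon>\<^sub>k\<close> for the
  output \<open>w\<^sub>k\<close> of stage \<open>k\<close>: after \<open>\<lceil>log \<alpha> (\<epsilon>0 / \<epsilon>)\<rceil>\<close> stages \<open>\<epsilon>\<^sub>k \<le> \<epsilon>\<close>, hence the \<open>2 * \<epsilon>\<close>.

  The number of iterations per stage can stay fixed because each restart is closer to its target.
  The target is not a minimizer but a point \<open>z\<close> with \<open>F z \<le> m + \<epsilon>\<close>.  A convex function that rises by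
  \<open>\<epsilon>\<close> within distance \<open>B\<close> of its minimizers rises at least at rate \<open>\<epsilon> / B\<close> from there on, so a
  point \<open>w\<close> has such a \<open>z\<close> within \<open>(B / \<epsilon>) * (F w - m - \<epsilon>)\<close>, or \<open>w\<close> itself will do
  (\<open>near_point_in_sublevel\<close>).  Under the invariant at \<open>k\<close> this distance is at most \<open>B * \<epsilon>\<^sub>k / \<epsilon>\<close>.
  The classical bound \<open>\<eta> * G\<^sup>2 / 2 + \<parallel>w - z\<parallel>\<^sup>2 / (2 * \<eta> * t)\<close> for the excess over \<open>F z\<close> at the average
  of \<open>t\<close> subgradient iterates (\<open>sg_average_bound\<close>) is then at most \<open>\<epsilon>\<^sub>k\<^sub>+\<^sub>1\<close> for the prescribed \<open>t\<close>
  and \<open>\<eta>\<close>, each of its terms contributing at most half (\<open>stage_contraction\<close>).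

  For the count of iterations only the rounding in \<open>t\<close> matters.  As \<open>F\<close> is \<open>G\<close>-Lipschitz, a rise by
  \<open>\<epsilon>\<close> needs a distance of at least \<open>\<epsilon> / G\<close>; so \<open>G * B \<ge> \<epsilon>\<close>, the number that is rounded up
  exceeds \<open>1\<close>, and rounding at most doubles it: \<open>C = 2\<close>.\<close>

section \<open>Growth of convex functions away from their minimizers\<close>

lemma lipschitz_of_bounded_subgradients:
  fixes F :: "'a::real_inner \<Rightarrow> real"
  assumes "\<And>x. x \<in> \<Omega> \<Longrightarrow> \<exists>v. norm v \<le> G \<and> (\<forall>u\<in>\<Omega>. F x + v \<bullet> (u - x) \<le> F u)"
    and "x \<in> \<Omega>" "y \<in> \<Omega>"
  shows "F x - F y \<le> G * dist x y"
proof -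
  obtain v where v: "norm v \<le> G" "F x + v \<bullet> (y - x) \<le> F y"
    using assms by blast
  have "F x - F y \<le> v \<bullet> (x - y)"
    using v(2) by (simp add: inner_diff_right)
  also have "\<dots> \<le> norm v * norm (x - y)"
    by (rule norm_cauchy_schwarz)
  also have "\<dots> \<le> G * dist x y"
    using v(1) by (simp add: dist_norm mult_right_mono)
  finally show ?thesis .
qed

text \<open>A point of \<open>M\<close> closer to \<open>z\<close> than \<open>u\<close> would, by the triangle inequality, also be closer to \<open>w\<close>
  than \<open>u\<close>, because \<open>z\<close> lies between \<open>u\<close> and \<open>w\<close>.\<close>

lemma infdist_along_segment:
  fixes M :: "'a::euclidean_space set"
  assumes "closed M" "u \<in> M" "infdist w M = dist w u" "z \<in> closed_segment u w"
  shows "infdist z M = dist z u"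
proof (rule antisym)
  show "infdist z M \<le> dist z u"
    using assms by (simp add: infdist_le)
  obtain v where v: "v \<in> M" "infdist z M = dist z v"
    using infdist_attains_inf[of M z] assms by auto
  have "dist w u \<le> dist w v"
    using assms v infdist_le[of v M w] by simp
  moreover have "dist w v \<le> dist w z + dist z v"
    by (rule dist_triangle)
  moreover have "dist w u = dist w z + dist z u"
    using assms(4) by (metis between between_mem_segment dist_commute add.commute)
  ultimately show "dist z u \<le> infdist z M"
    using v by simp
qed

text \<open>The point \<open>z\<close> is where the segment from the minimizer \<open>u\<close> nearest to \<open>w\<close> crosses the level
  \<open>m + \<epsilon>\<close>.  As \<open>u\<close> is also nearest to \<open>z\<close>, the part of the segment below the level has length at
  most \<open>B\<close>; convexity compares the part above it with the excess of \<open>F w\<close>.\<close>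

lemma near_point_on_level_set:
  fixes F :: "'a::euclidean_space \<Rightarrow> real"
  assumes conv: "convex_on \<Omega> F" and cont: "continuous_on \<Omega> F" and "closed \<Omega>"
    and M: "M = {u \<in> \<Omega>. F u = m}" "M \<noteq> {}"
    and "\<epsilon> > 0"
    and B: "\<And>z. z \<in> \<Omega> \<Longrightarrow> F z = m + \<epsilon> \<Longrightarrow> infdist z M \<le> B"
    and w: "w \<in> \<Omega>" "m + \<epsilon> \<le> F w"
  obtains z where "z \<in> \<Omega>" "F z = m + \<epsilon>" "dist w z \<le> B / \<epsilon> * (F w - m - \<epsilon>)"
proof -
  have "closed M"
    unfolding M(1) using cont \<open>closed \<Omega>\<close> by (rule continuous_closed_preimage_constant)
  then obtain u where u: "u \<in> M" "infdist w M = dist w u"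
    using infdist_attains_inf[of M w] M(2) by metis
  have uO: "u \<in> \<Omega>" "F u = m"
    using u M by auto
  have seg: "closed_segment u w \<subseteq> \<Omega>"
    using convex_on_imp_convex[OF conv] uO w by (simp add: closed_segment_subset)
  define p where "p s = (1 - s) *\<^sub>R u + s *\<^sub>R w" for s :: real
  have p: "p s \<in> closed_segment u w" if "0 \<le> s" "s \<le> 1" for s
    using that by (auto simp: p_def closed_segment_def)
  have "continuous_on {0..1} (\<lambda>s. F (p s))"
    by (rule continuous_on_compose2[OF cont]) (use p seg in \<open>auto simp: p_def intro!: continuous_intros\<close>)
  then obtain s where s: "0 \<le> s" "s \<le> 1" "F (p s) = m + \<epsilon>"
    using IVT'[of "\<lambda>s. F (p s)" 0 "m + \<epsilon>" 1] uO w \<open>\<epsilon> > 0\<close> by (auto simp: p_def)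
  have sF: "\<epsilon> \<le> s * (F w - m)"
    using convex_onD[OF conv s(1,2) uO(1) w(1)] s(3) uO(2)
    by (simp add: p_def algebra_simps)
  have "s > 0"
    using sF s(1) \<open>\<epsilon> > 0\<close> by (cases "s = 0") auto
  have "p s - u = s *\<^sub>R (w - u)" "w - p s = (1 - s) *\<^sub>R (w - u)"
    by (simp_all add: p_def algebra_simps)
  then have d: "dist (p s) u = s * dist w u" "dist w (p s) = (1 - s) * dist w u"
    using s by (simp_all add: dist_norm)
  have "s * dist w u \<le> B"
    using B[of "p s"] infdist_along_segment[OF \<open>closed M\<close> u p[OF s(1,2)]] s p seg d by auto
  have "\<epsilon> * (s * dist w (p s)) = \<epsilon> * (1 - s) * (s * dist w u)"
    using d by simp
  also have "\<dots> \<le> \<epsilon> * (1 - s) * B"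
    using s \<open>\<epsilon> > 0\<close> \<open>s * dist w u \<le> B\<close> by (intro mult_left_mono) auto
  also have "\<dots> \<le> s * (F w - m - \<epsilon>) * B"
  proof (intro mult_right_mono)
    show "\<epsilon> * (1 - s) \<le> s * (F w - m - \<epsilon>)"
      using sF by (simp add: algebra_simps)
    show "0 \<le> B"
      using \<open>s * dist w u \<le> B\<close> s(1) by (meson mult_nonneg_nonneg order_trans zero_le_dist)
  qed
  finally have "s * (\<epsilon> * dist w (p s)) \<le> s * (B * (F w - m - \<epsilon>))"
    by (simp add: mult_ac)
  then have "\<epsilon> * dist w (p s) \<le> B * (F w - m - \<epsilon>)"
    using \<open>s > 0\<close> by simp
  then have "dist w (p s) \<le> B / \<epsilon> * (F w - m - \<epsilon>)"
    using \<open>\<epsilon> > 0\<close> by (simp add: field_simps)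
  then show thesis
    using that[of "p s"] s p seg by blast
qed

corollary near_point_in_sublevel:
  fixes F :: "'a::euclidean_space \<Rightarrow> real"
  assumes "convex_on \<Omega> F" "continuous_on \<Omega> F" "closed \<Omega>"
    and "M = {u \<in> \<Omega>. F u = m}" "M \<noteq> {}"
    and "\<epsilon> > 0" "B \<ge> 0" "\<delta> \<ge> 0"
    and "\<And>z. z \<in> \<Omega> \<Longrightarrow> F z = m + \<epsilon> \<Longrightarrow> infdist z M \<le> B"
    and w: "w \<in> \<Omega>" "F w \<le> m + \<epsilon> + \<delta>"
  obtains z where "z \<in> \<Omega>" "F z \<le> m + \<epsilon>" "dist w z \<le> B / \<epsilon> * \<delta>"
proof (cases "F w \<le> m + \<epsilon>")
  case True
  then show ?thesis
    using that[of w] assms by simp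
next
  case False
  then obtain z where z: "z \<in> \<Omega>" "F z = m + \<epsilon>" "dist w z \<le> B / \<epsilon> * (F w - m - \<epsilon>)"
    using near_point_on_level_set[OF assms(1-6,9) w(1)] by auto
  have "B / \<epsilon> * (F w - m - \<epsilon>) \<le> B / \<epsilon> * \<delta>"
    using assms by (intro mult_left_mono) auto
  then show ?thesis
    using that[of z] z by simp
qed

section \<open>One stage of projected subgradient steps\<close>

lemma sg_iterate_in:
  assumes "closed \<Omega>" "x1 \<in> \<Omega>"
  shows "sg_iterate \<Omega> \<eta> g x1 n \<in> \<Omega>"
  using assms by (induction n) (auto intro: closest_point_in_set)

lemma sg_average_in:
  assumes "closed \<Omega>" "convex \<Omega>" "x1 \<in> \<Omega>" "t > 0"
  shows "sg_average \<Omega> \<eta> g x1 t \<in> \<Omega>"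
  unfolding sg_average_def scaleR_sum_right
  by (rule convex_sum) (use assms in \<open>auto intro: sg_iterate_in\<close>)

text \<open>Projection onto \<open>\<Omega>\<close> does not increase the distance to \<open>z \<in> \<Omega>\<close>, and the subgradient inequality
  bounds the cross term of the expanded square.\<close>

lemma projected_subgradient_step:
  fixes x z v :: "'a::euclidean_space"
  assumes "closed \<Omega>" "convex \<Omega>" "z \<in> \<Omega>" "\<eta> \<ge> 0"
    and v: "norm v \<le> G" and sub: "F x + v \<bullet> (z - x) \<le> F z"
  shows "(dist (closest_point \<Omega> (x - \<eta> *\<^sub>R v)) z)\<^sup>2 \<le>
    (dist x z)\<^sup>2 - 2 * \<eta> * (F x - F z) + \<eta>\<^sup>2 * G\<^sup>2"
proof -
  have "dist (closest_point \<Omega> (x - \<eta> *\<^sub>R v)) z \<le> dist (x - \<eta> *\<^sub>R v) z"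
    using closest_point_lipschitz[of \<Omega> "x - \<eta> *\<^sub>R v" z] assms
    by (auto simp: closest_point_self)
  then have "(dist (closest_point \<Omega> (x - \<eta> *\<^sub>R v)) z)\<^sup>2 \<le> (dist (x - \<eta> *\<^sub>R v) z)\<^sup>2"
    by (simp add: power_mono)
  also have "\<dots> = (dist x z)\<^sup>2 + 2 * \<eta> * (v \<bullet> (z - x)) + \<eta>\<^sup>2 * (norm v)\<^sup>2"
    unfolding dist_norm power2_norm_eq_inner
    by (simp add: inner_diff_left inner_diff_right inner_commute power2_eq_square algebra_simps)
  also have "\<dots> \<le> (dist x z)\<^sup>2 + 2 * \<eta> * (F z - F x) + \<eta>\<^sup>2 * G\<^sup>2"
    using sub v \<open>\<eta> \<ge> 0\<close> by (intro add_mono mult_left_mono power_mono) auto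
  finally show ?thesis
    by (simp add: algebra_simps)
qed

text \<open>Summing the step inequality telescopes the squared distances; Jensen's inequality passes from
  the mean of the values to the value at the mean.\<close>

lemma sg_average_bound:
  assumes conv: "convex_on \<Omega> F" and "closed \<Omega>" and "x1 \<in> \<Omega>" "z \<in> \<Omega>" "\<eta> > 0" "t > 0"
    and g: "\<And>\<tau> x. x \<in> \<Omega> \<Longrightarrow> norm (g \<tau> x) \<le> G"
      "\<And>\<tau> x. x \<in> \<Omega> \<Longrightarrow> F x + g \<tau> x \<bullet> (z - x) \<le> F z"
  shows "F (sg_average \<Omega> \<eta> g x1 t) - F z \<le> \<eta> * G\<^sup>2 / 2 + (dist x1 z)\<^sup>2 / (2 * \<eta> * real t)"
proof -
  let ?x = "sg_iterate \<Omega> \<eta> g x1"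
  have cvx: "convex \<Omega>"
    using conv by (rule convex_on_imp_convex)
  have xin: "?x n \<in> \<Omega>" for n
    using assms by (intro sg_iterate_in)
  have sum: "2 * \<eta> * (\<Sum>n<N. F (?x n) - F z) \<le>
      (dist x1 z)\<^sup>2 - (dist (?x N) z)\<^sup>2 + real N * (\<eta>\<^sup>2 * G\<^sup>2)" for N
  proof (induction N)
    case (Suc N)
    have "(dist (?x (Suc N)) z)\<^sup>2 \<le> (dist (?x N) z)\<^sup>2 - 2 * \<eta> * (F (?x N) - F z) + \<eta>\<^sup>2 * G\<^sup>2"
      using projected_subgradient_step[OF \<open>closed \<Omega>\<close> cvx \<open>z \<in> \<Omega>\<close> _ g[OF xin]] \<open>\<eta> > 0\<close>
      by simp
    then show ?case
      using Suc.IH by (simp add: algebra_simps)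
  qed simp
  have shift: "(\<Sum>\<tau>=1..t. h (\<tau> - 1)) = (\<Sum>n<t. h n)" for h :: "nat \<Rightarrow> 'b::comm_monoid_add"
    by (rule sum.reindex_bij_witness[of _ Suc "\<lambda>\<tau>. \<tau> - 1"]) auto
  have "sg_average \<Omega> \<eta> g x1 t = (\<Sum>n<t. (1 / real t) *\<^sub>R ?x n)"
    unfolding sg_average_def shift scaleR_sum_right ..
  then have "F (sg_average \<Omega> \<eta> g x1 t) \<le> (\<Sum>n<t. (1 / real t) * F (?x n))"
    using convex_on_sum[OF _ _ conv, of "{..<t}" "\<lambda>_. 1 / real t" ?x] xin \<open>t > 0\<close>
    by (auto simp: lessThan_empty_iff)
  also have "\<dots> = F z + (\<Sum>n<t. F (?x n) - F z) / real t"
    using \<open>t > 0\<close> by (simp add: sum_subtractf sum_divide_distrib diff_divide_distrib)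
  finally have "F (sg_average \<Omega> \<eta> g x1 t) - F z \<le> (\<Sum>n<t. F (?x n) - F z) / real t"
    by simp
  also have "\<dots> \<le> ((dist x1 z)\<^sup>2 + real t * (\<eta>\<^sup>2 * G\<^sup>2)) / (2 * \<eta>) / real t"
  proof (rule divide_right_mono)
    have "2 * \<eta> * (\<Sum>n<t. F (?x n) - F z) \<le> (dist x1 z)\<^sup>2 + real t * (\<eta>\<^sup>2 * G\<^sup>2)"
      using sum[of t] zero_le_power2[of "dist (?x t) z"] by linarith
    then show "(\<Sum>n<t. F (?x n) - F z) \<le> ((dist x1 z)\<^sup>2 + real t * (\<eta>\<^sup>2 * G\<^sup>2)) / (2 * \<eta>)"
      using \<open>\<eta> > 0\<close> by (simp add: field_simps)
  qed simp
  also have "\<dots> = \<eta> * G\<^sup>2 / 2 + (dist x1 z)\<^sup>2 / (2 * \<eta> * real t)"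
    using \<open>\<eta> > 0\<close> \<open>t > 0\<close> by (simp add: field_simps power2_eq_square)
  finally show ?thesis .
qed

section \<open>Restarting\<close>

text \<open>The step size \<open>\<delta> / G\<^sup>2\<close> makes the first term of \<open>sg_average_bound\<close> equal to \<open>\<delta> / 2\<close>; the lower
  bound on \<open>t\<close> is what brings the second one below \<open>\<delta> / 2\<close>.\<close>

lemma stage_contraction:
  assumes conv: "convex_on \<Omega> F" and cont: "continuous_on \<Omega> F" and clo: "closed \<Omega>"
    and M: "M = {u \<in> \<Omega>. F u = m}" "M \<noteq> {}"
    and pos: "\<epsilon> > 0" "B \<ge> 0" "\<delta> > 0" "\<alpha> > 0" "G > 0"
    and B: "\<And>z. z \<in> \<Omega> \<Longrightarrow> F z = m + \<epsilon> \<Longrightarrow> infdist z M \<le> B"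
    and w: "w \<in> \<Omega>" "F w \<le> m + \<epsilon> + \<alpha> * \<delta>"
    and t: "t > 0" "\<alpha>\<^sup>2 * G\<^sup>2 * B\<^sup>2 / \<epsilon>\<^sup>2 \<le> real t"
    and g: "\<And>\<tau> x. x \<in> \<Omega> \<Longrightarrow> norm (g \<tau> x) \<le> G"
      "\<And>\<tau> x u. x \<in> \<Omega> \<Longrightarrow> u \<in> \<Omega> \<Longrightarrow> F x + g \<tau> x \<bullet> (u - x) \<le> F u"
  shows "F (sg_average \<Omega> (\<delta> / G\<^sup>2) g w t) \<le> m + \<epsilon> + \<delta>"
proof -
  have "0 \<le> \<alpha> * \<delta>"
    using pos by simp
  from near_point_in_sublevel[OF conv cont clo M pos(1,2) this B w]
  obtain z where z: "z \<in> \<Omega>" "F z \<le> m + \<epsilon>" "dist w z \<le> B / \<epsilon> * (\<alpha> * \<delta>)"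
    by blast
  let ?\<eta> = "\<delta> / G\<^sup>2"
  have eta: "?\<eta> > 0"
    using pos by simp
  have "(dist w z)\<^sup>2 \<le> (B / \<epsilon> * (\<alpha> * \<delta>))\<^sup>2"
    using z(3) by (simp add: power_mono)
  also have "\<dots> = \<alpha>\<^sup>2 * G\<^sup>2 * B\<^sup>2 / \<epsilon>\<^sup>2 * (\<delta> * ?\<eta>)"
    using pos by (simp add: power_mult_distrib power_divide power2_eq_square[of \<delta>])
  also have "\<dots> \<le> real t * (\<delta> * ?\<eta>)"
    using t(2) pos by (intro mult_right_mono) auto
  finally have "(dist w z)\<^sup>2 / (2 * ?\<eta> * real t) \<le> real t * (\<delta> * ?\<eta>) / (2 * ?\<eta> * real t)"
    using pos by (intro divide_right_mono) auto
  also have "\<dots> = \<delta> / 2"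
    using pos t(1) by simp
  finally have "(dist w z)\<^sup>2 / (2 * ?\<eta> * real t) \<le> \<delta> / 2" .
  moreover have "?\<eta> * G\<^sup>2 / 2 = \<delta> / 2"
    using pos by simp
  moreover have "F (sg_average \<Omega> ?\<eta> g w t) - F z \<le>
      ?\<eta> * G\<^sup>2 / 2 + (dist w z)\<^sup>2 / (2 * ?\<eta> * real t)"
    using conv clo w(1) z(1) eta t(1) g(1) g(2)[OF _ z(1)] by (rule sg_average_bound)
  ultimately show ?thesis
    using z(2) by linarith
qed

lemma RSG_invariant:
  assumes conv: "convex_on \<Omega> F" and cont: "continuous_on \<Omega> F" and clo: "closed \<Omega>"
    and M: "M = {u \<in> \<Omega>. F u = m}" "M \<noteq> {}"
    and pos: "\<epsilon> > 0" "B \<ge> 0" "\<epsilon>0 > 0" "\<alpha> > 0" "G > 0"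
    and B: "\<And>z. z \<in> \<Omega> \<Longrightarrow> F z = m + \<epsilon> \<Longrightarrow> infdist z M \<le> B"
    and w0: "w0 \<in> \<Omega>" "F w0 \<le> m + \<epsilon>0"
    and t: "t > 0" "\<alpha>\<^sup>2 * G\<^sup>2 * B\<^sup>2 / \<epsilon>\<^sup>2 \<le> real t"
    and g: "\<And>k \<tau> x. x \<in> \<Omega> \<Longrightarrow> norm (orc k \<tau> x) \<le> G"
      "\<And>k \<tau> x u. x \<in> \<Omega> \<Longrightarrow> u \<in> \<Omega> \<Longrightarrow> F x + orc k \<tau> x \<bullet> (u - x) \<le> F u"
  shows "RSG \<Omega> G \<epsilon>0 orc w0 k t \<alpha> \<in> \<Omega> \<and> F (RSG \<Omega> G \<epsilon>0 orc w0 k t \<alpha>) \<le> m + \<epsilon> + \<epsilon>0 / \<alpha> ^ k"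
proof (induction k)
  case 0
  then show ?case
    using w0 pos by simp
next
  case (Suc k)
  let ?w = "RSG \<Omega> G \<epsilon>0 orc w0 k t \<alpha>" and ?\<delta> = "\<epsilon>0 / \<alpha> ^ Suc k"
  have w: "?w \<in> \<Omega>" "F ?w \<le> m + \<epsilon> + \<alpha> * ?\<delta>" and "?\<delta> > 0"
    using Suc.IH pos by simp_all
  have "F (sg_average \<Omega> (?\<delta> / G\<^sup>2) (orc (Suc k)) ?w t) \<le> m + \<epsilon> + ?\<delta>"
    by (rule stage_contraction[OF conv cont clo M pos(1,2) _ pos(4,5)]) (fact \<open>?\<delta> > 0\<close> B w t g)+
  moreover have "sg_average \<Omega> (?\<delta> / G\<^sup>2) (orc (Suc k)) ?w t \<in> \<Omega>"
    using clo convex_on_imp_convex[OF conv] w(1) t(1) by (rule sg_average_in)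
  ultimately show ?case
    by simp
qed

lemma stages_suffice:
  fixes \<alpha> \<epsilon> \<epsilon>0 :: real
  assumes "\<alpha> > 1" "\<epsilon> > 0" "\<epsilon>0 > 0"
  shows "\<epsilon>0 / \<alpha> ^ nat \<lceil>log \<alpha> (\<epsilon>0 / \<epsilon>)\<rceil> \<le> \<epsilon>"
proof -
  have "\<epsilon>0 / \<epsilon> = \<alpha> powr log \<alpha> (\<epsilon>0 / \<epsilon>)"
    using assms by simp
  also have "\<dots> \<le> \<alpha> powr real (nat \<lceil>log \<alpha> (\<epsilon>0 / \<epsilon>)\<rceil>)"
    using assms by (intro powr_mono real_nat_ceiling_ge) auto
  also have "\<dots> = \<alpha> ^ nat \<lceil>log \<alpha> (\<epsilon>0 / \<epsilon>)\<rceil>"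
    using assms by (simp add: powr_realpow)
  finally show ?thesis
    using assms by (simp add: field_simps)
qed

lemma iteration_count:
  fixes a l :: real
  assumes "a \<ge> 1" "l \<ge> 0"
  shows "real (nat \<lceil>a\<rceil> * nat \<lceil>l\<rceil>) \<le> 2 * a * real_of_int \<lceil>l\<rceil>"
proof -
  have "real (nat \<lceil>a\<rceil>) \<le> 2 * a" "real (nat \<lceil>l\<rceil>) = real_of_int \<lceil>l\<rceil>"
    using assms by linarith+
  then show ?thesis
    using assms by (simp add: mult_right_mono)
qed

section \<open>Passage from extended to real values\<close>

lemma convex_on_of_ext_convex:
  assumes "ext_convex f" "convex \<Omega>" and F: "\<And>w. w \<in> \<Omega> \<Longrightarrow> f w = ereal (F w)"
  shows "convex_on \<Omega> F"
proof (rule convex_onI)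
  fix s :: real and x y
  assume s: "0 < s" "s < 1" and xy: "x \<in> \<Omega>" "y \<in> \<Omega>"
  have "(1 - s) *\<^sub>R x + s *\<^sub>R y \<in> \<Omega>"
    using assms(2) s xy by (simp add: convexD)
  moreover have "f ((1 - s) *\<^sub>R x + s *\<^sub>R y) \<le> ereal (1 - s) * f x + ereal s * f y"
    using assms(1) s unfolding ext_convex_def by simp
  ultimately show "F ((1 - s) *\<^sub>R x + s *\<^sub>R y) \<le> (1 - s) * F x + s * F y"
    using F xy by simp
qed (fact assms(2))

lemma subdifferential_real:
  assumes "v \<in> subdifferential f x" "f x = ereal (F x)" "f u = ereal (F u)"
  shows "F x + v \<bullet> (u - x) \<le> F u"
proof -
  have "f x + ereal (v \<bullet> (u - x)) \<le> f u"
    using assms(1) by (simp add: subdifferential_def)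
  then show ?thesis
    using assms(2,3) by simp
qed

lemma min_value_eq:
  assumes "u \<in> minimizers f \<Omega>"
  shows "min_value f \<Omega> = f u"
  unfolding min_value_def
  by (rule INF_eqI) (use assms in \<open>auto simp: minimizers_def\<close>)

theorem corollary5:
  fixes f :: "real^'d \<Rightarrow> ereal" and \<Omega> :: "(real^'d) set"
    and w0 :: "real^'d" and G \<alpha> \<epsilon>0 :: real
  assumes "\<And>w. f w \<noteq> -\<infinity>"
    and "lower_semicont f" and "ext_convex f"
    and "closed \<Omega>" and "convex \<Omega>" and "\<Omega> \<subseteq> eff_dom f"
    and "minimizers f \<Omega> \<noteq> {}"
    and "G > 0"
    and "\<And>w. w \<in> \<Omega> \<Longrightarrow> subdifferential f w \<noteq> {}"
    and "\<And>w v. w \<in> \<Omega> \<Longrightarrow> v \<in> subdifferential f w \<Longrightarrow> norm v \<le> G"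
    and "w0 \<in> \<Omega>" and "\<alpha> > 1" and "\<epsilon>0 > 0"
    and "f w0 - min_value f \<Omega> \<le> ereal \<epsilon>0"
  shows "\<exists>C>0. \<forall>\<epsilon>\<in>{0<..\<epsilon>0}.
    level_set f \<Omega> \<epsilon> \<noteq> {} \<longrightarrow> bdd_above (level_dists f \<Omega> \<epsilon>) \<longrightarrow>
    (let B = level_radius f \<Omega> \<epsilon>;
         t = nat \<lceil>\<alpha>\<^sup>2 * G\<^sup>2 * B\<^sup>2 / \<epsilon>\<^sup>2\<rceil>;
         K = nat \<lceil>log \<alpha> (\<epsilon>0 / \<epsilon>)\<rceil>
     in (\<forall>orc. subgradient_oracle f \<Omega> orc \<longrightarrow>
           f (RSG \<Omega> G \<epsilon>0 orc w0 K t \<alpha>) - min_value f \<Omega> \<le> ereal (2 * \<epsilon>)) \<and>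
        real (t * K) \<le> C * (\<alpha>\<^sup>2 * G\<^sup>2 * B\<^sup>2 / \<epsilon>\<^sup>2) * real_of_int \<lceil>log \<alpha> (\<epsilon>0 / \<epsilon>)\<rceil>)"
proof -
  define F where "F w = real_of_ereal (f w)" for w
  have F: "f w = ereal (F w)" if "w \<in> \<Omega>" for w
    using that assms(1)[of w] assms(6) by (auto simp: F_def eff_dom_def ereal_real)
  define M where "M = minimizers f \<Omega>"
  obtain u where u: "u \<in> M"
    using assms(7) by (auto simp: M_def)
  define m where "m = F u"
  have uO: "u \<in> \<Omega>"
    using u by (simp add: M_def minimizers_def)
  have mv: "min_value f \<Omega> = ereal m"
    using min_value_eq[of u f] u F[OF uO] by (simp add: M_def m_def)
  have M: "M = {w \<in> \<Omega>. F w = m}"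
    using u F by (force simp: M_def m_def minimizers_def)
  have L: "level_set f \<Omega> \<epsilon> = {w \<in> \<Omega>. F w = m + \<epsilon>}" for \<epsilon>
    using F mv by (auto simp: level_set_def)
  have conv: "convex_on \<Omega> F"
    using convex_on_of_ext_convex[OF assms(3,5)] F by blast
  have sub: "F x + v \<bullet> (y - x) \<le> F y" if "v \<in> subdifferential f x" "x \<in> \<Omega>" "y \<in> \<Omega>" for v x y
    using subdifferential_real that F by blast
  have lip: "F x - F y \<le> G * dist x y" if "x \<in> \<Omega>" "y \<in> \<Omega>" for x y
    using that
  proof (rule lipschitz_of_bounded_subgradients[rotated])
    fix x assume x: "x \<in> \<Omega>"
    then obtain v where "v \<in> subdifferential f x"
      using assms(9) by blast
    then show "\<exists>v. norm v \<le> G \<and> (\<forall>u\<in>\<Omega>. F x + v \<bullet> (u - x) \<le> F u)"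
      using assms(10) sub x by blast
  qed
  have "G-lipschitz_on \<Omega> F"
  proof (rule lipschitz_onI)
    show "dist (F x) (F y) \<le> G * dist x y" if "x \<in> \<Omega>" "y \<in> \<Omega>" for x y
      using lip[OF that] lip[OF that(2,1)] by (simp add: dist_real_def dist_commute abs_le_iff)
  qed (use assms(8) in simp)
  then have cont: "continuous_on \<Omega> F"
    by (rule lipschitz_on_continuous_on)
  have w0: "F w0 \<le> m + \<epsilon>0"
    using assms(14) F[OF assms(11)] mv by simp
  show ?thesis
  proof (intro exI[of _ "2::real"] conjI ballI impI)
    fix \<epsilon>
    assume eps: "\<epsilon> \<in> {0<..\<epsilon>0}" and ne: "level_set f \<Omega> \<epsilon> \<noteq> {}"
      and bdd: "bdd_above (level_dists f \<Omega> \<epsilon>)"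
    define B where "B = level_radius f \<Omega> \<epsilon>"
    define a where "a = \<alpha>\<^sup>2 * G\<^sup>2 * B\<^sup>2 / \<epsilon>\<^sup>2"
    define K where "K = nat \<lceil>log \<alpha> (\<epsilon>0 / \<epsilon>)\<rceil>"
    have B: "infdist z M \<le> B" if "z \<in> \<Omega>" "F z = m + \<epsilon>" for z
      unfolding B_def level_radius_def
      by (rule cSup_upper[OF _ bdd]) (use that in \<open>auto simp: level_dists_def L M_def\<close>)
    obtain w where w: "w \<in> \<Omega>" "F w = m + \<epsilon>"
      using ne L by auto
    have "closed M"
      unfolding M using cont assms(4) by (rule continuous_closed_preimage_constant)
    then obtain v where v: "v \<in> M" "infdist w M = dist w v"
      using infdist_attains_inf[of M w] u by blast
    have "\<epsilon> \<le> G * dist w v"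
      using lip[of w v] w v(1) M by auto
    also have "\<dots> \<le> G * B"
      using B[OF w] v(2) assms(8) by simp
    finally have GB: "\<epsilon> \<le> G * B" .
    have "B \<ge> 0"
      using B[OF w] infdist_nonneg[of w M] by linarith
    have "\<epsilon> \<le> \<alpha> * (G * B)"
      using mult_mono[of 1 \<alpha> \<epsilon> "G * B"] GB eps assms(12) by simp
    then have "\<epsilon>\<^sup>2 \<le> (\<alpha> * (G * B))\<^sup>2"
      using eps by (intro power_mono) auto
    then have a1: "a \<ge> 1"
      using eps by (simp add: a_def power_mult_distrib mult_ac)
    have "f (RSG \<Omega> G \<epsilon>0 orc w0 K (nat \<lceil>a\<rceil>) \<alpha>) - min_value f \<Omega> \<le> ereal (2 * \<epsilon>)"
      if orc: "subgradient_oracle f \<Omega> orc" for orc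
    proof -
      let ?w = "RSG \<Omega> G \<epsilon>0 orc w0 K (nat \<lceil>a\<rceil>) \<alpha>"
      have o: "orc k \<tau> x \<in> subdifferential f x" if "x \<in> \<Omega>" for k \<tau> x
        using orc that by (simp add: subgradient_oracle_def)
      have "?w \<in> \<Omega> \<and> F ?w \<le> m + \<epsilon> + \<epsilon>0 / \<alpha> ^ K"
      proof (rule RSG_invariant[OF conv cont assms(4) M])
        show "0 < nat \<lceil>a\<rceil>" "\<alpha>\<^sup>2 * G\<^sup>2 * B\<^sup>2 / \<epsilon>\<^sup>2 \<le> real (nat \<lceil>a\<rceil>)"
          using a1 by (auto simp: real_nat_ceiling_ge simp flip: a_def)
        show "M \<noteq> {}" "\<epsilon> > 0" "\<alpha> > 0"
          using u eps assms(12) by auto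
        show "norm (orc k \<tau> x) \<le> G" if "x \<in> \<Omega>" for k \<tau> x
          using assms(10) that o by blast
        show "F x + orc k \<tau> x \<bullet> (y - x) \<le> F y" if "x \<in> \<Omega>" "y \<in> \<Omega>" for k \<tau> x y
          using sub o that by blast
      qed (fact \<open>B \<ge> 0\<close> assms B w0)+
      moreover have "\<epsilon>0 / \<alpha> ^ K \<le> \<epsilon>"
        unfolding K_def using assms(12,13) eps by (intro stages_suffice) auto
      ultimately show ?thesis
        using F[of ?w] mv by simp
    qed
    moreover have "real (nat \<lceil>a\<rceil> * K) \<le> 2 * a * real_of_int \<lceil>log \<alpha> (\<epsilon>0 / \<epsilon>)\<rceil>"
      unfolding K_def using a1 eps assms(12) by (intro iteration_count) auto
    ultimately show "let B = level_radius f \<Omega> \<epsilon>;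
         t = nat \<lceil>\<alpha>\<^sup>2 * G\<^sup>2 * B\<^sup>2 / \<epsilon>\<^sup>2\<rceil>;
         K = nat \<lceil>log \<alpha> (\<epsilon>0 / \<epsilon>)\<rceil>
     in (\<forall>orc. subgradient_oracle f \<Omega> orc \<longrightarrow>
           f (RSG \<Omega> G \<epsilon>0 orc w0 K t \<alpha>) - min_value f \<Omega> \<le> ereal (2 * \<epsilon>)) \<and>
        real (t * K) \<le> 2 * (\<alpha>\<^sup>2 * G\<^sup>2 * B\<^sup>2 / \<epsilon>\<^sup>2) * real_of_int \<lceil>log \<alpha> (\<epsilon>0 / \<epsilon>)\<rceil>"
      unfolding Let_def a_def B_def K_def by blast
  qed simp
qed

end
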